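(* Let $\phi>0$, let $W_\phi\sim \mathrm{EF}(\phi)$, and for each $\lambda>0$ let $N_\lambda\sim \mathrm{MP}(\lambda,W_\phi)$. Let $\{X_n\}_{n\ge 1}$ be a sequence of i.i.d. real random variables, independent of $N_\lambda$, with $E(X_1)=\mu\in\mathbb{R}$ and $\mathrm{Var}(X_1)=\sigma^2>0$ (finite). Put $a_\lambda=\frac{1}{\sqrt{\lambda}}$ and $d_\lambda=\mu\left(\frac{1}{\sqrt{\lambda}}-1\right)$. Then, as $\lambda\to\infty$, $$\widetilde S_\lambda = a_\lambda\sum_{i=1}^{N_\lambda}(X_i+d_\lambda)\ \xrightarrow{\ d\ }\ Y,$$ where $Y$ is a random variable with characteristic function $$\psi_Y(t)=\exp\left[-\phi\left\{b(\xi_0)-b\left[\xi_0+\phi^{-1}\left(it\mu-\frac{t^2\sigma^2}{2}\right)\right]\right\}\right],\qquad t\in\mathbb{R}.$$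
   Context: Exponential family $\mathrm{EF}(\phi)$: $W_\phi$ is a strictly positive continuous random variable whose density with respect to a $\sigma$-finite measure $\nu$ is $$f_{W_\phi}(w)=\exp\{\phi[w\xi_0-b(\xi_0)]+c(w;\phi)\},\qquad w>0,\ \phi>0,$$ where $c:\mathbb{R}^+\times\mathbb{R}^+\to\mathbb{R}$, $b$ is continuous and three times differentiable, and $\xi_0$ is such that $b'(\xi_0)=1$. Here $b$ is the cumulant function of the exponential family: for every $\phi>0$ and every $\theta$ in an open interval $\Theta\supseteq(-\infty,\xi_0]$, the function $w\mapsto\exp\{\phi[w\theta-b(\theta)]+c(w;\phi)\}$ is a probability density with respect to $\nu$ on $(0,\infty)$. In particular $E(W_\phi)=b'(\xi_0)=1$ and $\mathrm{Var}(W_\phi)=\phi^{-1}b''(\xi_0)$. At complex arguments, $b$ denotes its analytic extension to $\{z\in\mathbb{C}:\mathrm{Re}\,z\in\Theta\}$. Mixed Poisson law: $N_\lambda\sim\mathrm{MP}(\lambda,W_\phi)$ means that, conditionally on $W_\phi=w$, $N_\lambda$ is Poisson with mean $\lambda w$. An empty sum (when $N_\lambda=0$) equals $0$. $\xrightarrow{d}$ denotes convergence in distribution. *)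

theory Defs
  imports "HOL-Probability.Probability"
begin

definition ef_density ::
    "(real \<Rightarrow> real) \<Rightarrow> (real \<Rightarrow> real \<Rightarrow> real) \<Rightarrow> real \<Rightarrow> real \<Rightarrow> real \<Rightarrow> real" where
  "ef_density b c \<phi> \<theta> w =
     (if 0 < w then exp (\<phi> * (w * \<theta> - b \<theta>) + c w \<phi>) else 0)"

text \<open>
  The data behind EF: one dominating measure, one cumulant function \<open>b\<close> and one function \<open>c\<close>
  serve all dispersion parameters \<open>\<phi> > 0\<close> simultaneously, as well as all canonical parameters
  \<open>\<theta> \<in> \<Theta>\<close>. Only the values of \<open>b\<close> on \<open>\<Theta>\<close> and of \<open>c\<close> on positive arguments matter.
\<close>

locale exponential_family = sigma_finite_measure \<nu>
  for \<nu> :: "real measure" +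
  fixes b :: "real \<Rightarrow> real"
    and c :: "real \<Rightarrow> real \<Rightarrow> real"
    and \<xi>0 :: real
    and \<Theta> :: "real set"
  assumes sets_nu: "sets \<nu> = sets borel"
    and open_Theta: "open \<Theta>"
    and interval_Theta: "is_interval \<Theta>"
    and Theta_lower: "{..\<xi>0} \<subseteq> \<Theta>"
    and b_continuous: "continuous_on \<Theta> b"
    and b_differentiable:
      "\<And>k \<theta>. k < 3 \<Longrightarrow> \<theta> \<in> \<Theta> \<Longrightarrow> (deriv ^^ k) b differentiable (at \<theta>)"
    and b_deriv_xi0: "deriv b \<xi>0 = 1"
    and density_measurable:
      "\<And>\<phi> \<theta>. 0 < \<phi> \<Longrightarrow> \<theta> \<in> \<Theta> \<Longrightarrow> ef_density b c \<phi> \<theta> \<in> borel_measurable \<nu>"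
    and density_total:
      "\<And>\<phi> \<theta>. 0 < \<phi> \<Longrightarrow> \<theta> \<in> \<Theta> \<Longrightarrow> (\<integral>\<^sup>+ w. ennreal (ef_density b c \<phi> \<theta> w) \<partial>\<nu>) = 1"

text \<open>
  For an exponential family as above the extension exists and is unique on the strip:
  \<open>exp (\<phi> * b)\<close> extends to the Laplace transform \<open>L \<phi>\<close> of a positive measure, and
  \<open>L \<phi> = L (\<phi> / n) ^ n\<close> for every \<open>n \<ge> 1\<close>, so \<open>L \<phi>\<close> has no zeros on the strip and has a
  holomorphic logarithm there; uniqueness is the identity theorem.
  Outside the strip the value is arbitrary.
\<close>

definition analytic_extension :: "real set \<Rightarrow> (real \<Rightarrow> real) \<Rightarrow> complex \<Rightarrow> complex" where
  "analytic_extension \<Theta> b =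
     (SOME B. B holomorphic_on {z. Re z \<in> \<Theta>} \<and>
              (\<forall>\<theta>\<in>\<Theta>. B (complex_of_real \<theta>) = complex_of_real (b \<theta>)))"

text \<open>\<open>W \<sim> EF(\<phi>)\<close>. ``Continuous'' is read as ``no point has positive probability''.\<close>

definition EF_distributed ::
    "'a measure \<Rightarrow> real measure \<Rightarrow> (real \<Rightarrow> real) \<Rightarrow> (real \<Rightarrow> real \<Rightarrow> real) \<Rightarrow> real \<Rightarrow> real
      \<Rightarrow> ('a \<Rightarrow> real) \<Rightarrow> bool" where
  "EF_distributed M \<nu> b c \<xi>0 \<phi> W \<longleftrightarrow>
     distributed M \<nu> W (\<lambda>w. ennreal (ef_density b c \<phi> \<xi>0 w)) \<and>
     (AE \<omega> in M. 0 < W \<omega>) \<and>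
     (\<forall>w. measure M {\<omega> \<in> space M. W \<omega> = w} = 0)"

text \<open>
  \<open>N \<sim> MP(l, W)\<close>: the conditional probability \<open>P(N = k | \<sigma>(W))\<close> is the Poisson
  probability of \<open>k\<close> with mean \<open>l * W\<close>.
\<close>

definition mixed_poisson :: "'a measure \<Rightarrow> real \<Rightarrow> ('a \<Rightarrow> real) \<Rightarrow> ('a \<Rightarrow> nat) \<Rightarrow> bool" where
  "mixed_poisson M l W N \<longleftrightarrow>
     W \<in> borel_measurable M \<and>
     N \<in> measurable M (count_space UNIV) \<and>
     (\<forall>k. AE \<omega> in M.
        real_cond_exp M (vimage_algebra (space M) W borel) (indicator {\<omega> \<in> space M. N \<omega> = k}) \<omega>
          = pmf (poisson_pmf (l * W \<omega>)) k)"

text \<open>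
  The library's \<open>indep_var\<close> forces both random variables to have the same value type, so
  independence of a sequence and a counting variable is stated for the generated
  \<open>\<sigma>\<close>-algebras.
\<close>

definition indep_rv ::
    "'a measure \<Rightarrow> 'b measure \<Rightarrow> ('a \<Rightarrow> 'b) \<Rightarrow> 'c measure \<Rightarrow> ('a \<Rightarrow> 'c) \<Rightarrow> bool" where
  "indep_rv M Ma A Mb B \<longleftrightarrow>
     A \<in> measurable M Ma \<and> B \<in> measurable M Mb \<and>
     prob_space.indep_set M
       (sets (vimage_algebra (space M) A Ma)) (sets (vimage_algebra (space M) B Mb))"

text \<open>
  Convergence in distribution along an arbitrary filter; the library's \<open>weak_conv_m\<close> covers
  sequences only.
\<close>

definition weak_conv_filter ::
    "('i \<Rightarrow> real measure) \<Rightarrow> real measure \<Rightarrow> 'i filter \<Rightarrow> bool" where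
  "weak_conv_filter \<mu>s \<mu> F \<longleftrightarrow>
     (\<forall>x. isCont (cdf \<mu>) x \<longrightarrow> ((\<lambda>i. cdf (\<mu>s i) x) \<longlongrightarrow> cdf \<mu> x) F)"

lemma weak_conv_filter_sequentially: "weak_conv_filter \<mu>s \<mu> sequentially \<longleftrightarrow> weak_conv_m \<mu>s \<mu>"
  by (simp add: weak_conv_filter_def weak_conv_m_def weak_conv_def)

end

theory Submission
  imports Defs "HOL-Complex_Analysis.Complex_Analysis"
begin

text \<open>
  Let \<open>g\<close> be the characteristic function of one summand at \<open>t\<close>. Conditioning on \<open>W\<close>, the compound
  mixed Poisson sum has characteristic function \<open>E (exp (l (g - 1) W))\<close>, and
  \<open>l (g - 1) \<longlonglongrightarrow> s = i t \<mu> - t\<^sup>2 \<sigma>\<^sup>2 / 2\<close> by a second-order expansion. As \<open>Re (l (g - 1)) \<le> 0\<close>, dominated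
  convergence gives the limit \<open>E (exp (s W))\<close>, which is the characteristic function of a normal
  variance-mean mixture, and Levy's theorem applies. To express this Laplace transform
  through \<open>b\<close>, one needs the analytic extension of \<open>b\<close>: the transform \<open>L\<close> of the
  law with parameter \<open>\<phi> = 1\<close> is holomorphic on the strip and, having an \<open>n\<close>-th root given by the
  parameter \<open>1 / n\<close> for every \<open>n\<close>, has no zeros there, so it has a holomorphic logarithm.
\<close>

section \<open>Laplace transforms on a vertical strip\<close>

text \<open>Mean value inequality on the disc about 0 of radius \<open>cmod z\<close>, where the
  derivative of \<open>exp\<close> has modulus at most \<open>exp (cmod z)\<close>.\<close>

lemma cmod_exp_minus_one_le: "cmod (exp z - 1) \<le> cmod z * exp (cmod z)"
proof -
  have "cmod (exp z - exp 0) \<le> exp (cmod z) * cmod (z - 0)"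
  proof (rule field_differentiable_bound[of "cball 0 (cmod z)" exp exp])
    show "\<And>w. w \<in> cball 0 (cmod z) \<Longrightarrow> cmod (exp w) \<le> exp (cmod z)"
      by (auto intro: order_trans[OF complex_Re_le_cmod])
  qed (auto intro: DERIV_exp has_field_derivative_at_within)
  thus ?thesis by (simp add: mult.commute)
qed

text \<open>The factor \<open>\<bar>w\<bar>\<close> costs one more exponential, because
  \<open>\<delta> * \<bar>w\<bar> \<le> exp (\<delta> * \<bar>w\<bar>)\<close>. Summing over both
  signs removes the absolute value, so that only exponentials linear in \<open>w\<close>
  remain.\<close>

lemma abs_mult_exp_le:
  fixes w \<delta> :: real
  assumes "0 < \<delta>"
  shows "\<bar>w\<bar> * exp (\<delta> * \<bar>w\<bar>) \<le> (exp (2 * \<delta> * w) + exp (- 2 * \<delta> * w)) / \<delta>"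
proof -
  have "\<delta> * \<bar>w\<bar> \<le> exp (\<delta> * \<bar>w\<bar>)" using exp_ge_add_one_self[of "\<delta> * \<bar>w\<bar>"] by linarith
  hence "\<delta> * \<bar>w\<bar> * exp (\<delta> * \<bar>w\<bar>) \<le> exp (\<delta> * \<bar>w\<bar>) * exp (\<delta> * \<bar>w\<bar>)"
    by (rule mult_right_mono) simp
  also have "\<dots> = exp (2 * \<delta> * \<bar>w\<bar>)" by (simp add: exp_add[symmetric])
  also have "\<dots> \<le> exp (2 * \<delta> * w) + exp (- 2 * \<delta> * w)" by (cases "w \<ge> 0") auto
  finally show ?thesis using assms by (simp add: field_simps)
qed

text \<open>After division by \<open>cmod h\<close> the bound no longer depends on \<open>h\<close>.
  It dominates the difference quotients of a Laplace transform, at the price of moving the exponent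
  by \<open>2 * \<delta>\<close> to either side.\<close>

lemma exp_times_cmod_exp_minus_one_le:
  fixes w x \<delta> :: real and h :: complex
  assumes "0 < \<delta>" "cmod h \<le> \<delta>"
  shows "exp (x * w) * cmod (exp (h * of_real w) - 1)
           \<le> cmod h * ((exp ((x + 2 * \<delta>) * w) + exp ((x - 2 * \<delta>) * w)) / \<delta>)"
proof -
  have "cmod (exp (h * of_real w) - 1) \<le> cmod h * (\<bar>w\<bar> * exp (cmod h * \<bar>w\<bar>))"
    using cmod_exp_minus_one_le[of "h * of_real w"] by (simp add: norm_mult mult.assoc)
  also have "\<dots> \<le> cmod h * (\<bar>w\<bar> * exp (\<delta> * \<bar>w\<bar>))"
    using assms by (intro mult_left_mono) (auto intro!: mult_right_mono)
  also have "\<dots> \<le> cmod h * ((exp (2 * \<delta> * w) + exp (- 2 * \<delta> * w)) / \<delta>)"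
    using abs_mult_exp_le[OF assms(1), of w] by (intro mult_left_mono) auto
  finally have "exp (x * w) * cmod (exp (h * of_real w) - 1) \<le>
     exp (x * w) * (cmod h * ((exp (2 * \<delta> * w) + exp (- 2 * \<delta> * w)) / \<delta>))"
    by (rule mult_left_mono) simp
  also have "\<dots> = cmod h * ((exp (x*w) * exp (2 * \<delta> * w) + exp (x*w) * exp (- 2 * \<delta> * w)) / \<delta>)"
    by (simp add: field_simps)
  also have "\<dots> = cmod h * ((exp ((x + 2 * \<delta>) * w) + exp ((x - 2 * \<delta>) * w)) / \<delta>)"
    unfolding exp_add[symmetric] by (simp add: algebra_simps)
  finally show ?thesis .
qed

lemma integrable_complex_exp:
  fixes Q :: "real measure"
  assumes [measurable_cong]: "sets Q = sets borel"
    and "integrable Q (\<lambda>w. exp (Re z * w))"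
  shows "integrable Q (\<lambda>w. exp (z * complex_of_real w))"
  by (rule Bochner_Integration.integrable_bound[OF assms(2)]) auto

lemma open_strip:
  assumes "open \<Theta>"
  shows "open {z. Re z \<in> \<Theta>}"
  using open_vimage[OF assms, of Re] by (simp add: vimage_def continuous_on_Re)

lemma convex_strip:
  assumes "is_interval \<Theta>"
  shows "convex {z. Re z \<in> \<Theta>}"
proof -
  have "convex (Re -` \<Theta>)" using assms
    by (intro convex_linear_vimage) (auto simp: is_interval_convex bounded_linear.linear bounded_linear_Re)
  thus ?thesis by (simp add: vimage_def)
qed

text \<open>Differentiation under the integral sign: dominated convergence is applied to the
  difference quotients along an arbitrary sequence of increments tending to 0.\<close>

lemma laplace_transform_holomorphic:
  fixes Q :: "real measure"
  assumes Q [measurable_cong]: "sets Q = sets borel" and "open \<Theta>"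
    and int: "\<And>\<theta>. \<theta> \<in> \<Theta> \<Longrightarrow> integrable Q (\<lambda>w. exp (\<theta> * w))"
  shows "(\<lambda>z. \<integral>w. exp (z * complex_of_real w) \<partial>Q) holomorphic_on {z. Re z \<in> \<Theta>}"
proof -
  show ?thesis unfolding holomorphic_on_open[OF open_strip[OF \<open>open \<Theta>\<close>]]
  proof (intro ballI)
    fix z assume "z \<in> {z. Re z \<in> \<Theta>}"
    hence z: "Re z \<in> \<Theta>" by simp
    obtain e where e: "0 < e" "ball (Re z) e \<subseteq> \<Theta>" using \<open>open \<Theta>\<close> z openE by blast
    \<comment> \<open>A quarter of \<open>e\<close> keeps the shifted exponents
      \<open>Re z + 2 * \<delta>\<close> and \<open>Re z - 2 * \<delta>\<close> inside the ball,
      where the exponentials are integrable.\<close>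
    define \<delta> where "\<delta> = e / 4"
    have \<delta>: "0 < \<delta>" using e by (simp add: \<delta>_def)
    have inT: "Re z + s \<in> \<Theta>" if "\<bar>s\<bar> \<le> 2 * \<delta>" for s
      using e that by (intro subsetD[OF e(2)]) (auto simp: dist_real_def \<delta>_def)
    let ?F = "\<lambda>z. \<integral>w. exp (z * complex_of_real w) \<partial>Q"
    let ?q = "\<lambda>h w. (exp ((z + h) * complex_of_real w) - exp (z * complex_of_real w)) / h"
    let ?D = "\<integral>w. complex_of_real w * exp (z * complex_of_real w) \<partial>Q"
    let ?g = "\<lambda>w. (exp ((Re z + 2 * \<delta>) * w) + exp ((Re z - 2 * \<delta>) * w)) / \<delta>"
    have gint: "integrable Q ?g"
      using inT[of "2*\<delta>"] inT[of "-2*\<delta>"] \<delta> int by (auto intro!: integrable_divide Bochner_Integration.integrable_add)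
    have "((\<lambda>h. (?F (z + h) - ?F z) / h) \<longlongrightarrow> ?D) (at 0)"
      unfolding tendsto_at_iff_sequentially comp_def
    proof (intro allI impI)
      fix h :: "nat \<Rightarrow> complex" assume h: "\<forall>i. h i \<in> UNIV - {0}" and h0: "h \<longlonglongrightarrow> 0"
      from h have hnz: "h i \<noteq> 0" for i by auto
      have "\<forall>\<^sub>F i in sequentially. cmod (h i) < \<delta>"
        using tendsto_norm_zero[OF h0] \<delta> by (rule order_tendstoD(2))
      then obtain k where k: "cmod (h i) < \<delta>" if "i \<ge> k" for i
        unfolding eventually_sequentially by blast
      \<comment> \<open>The shift by \<open>k\<close> makes the bound hold at every index, as the
        dominated convergence rule demands; \<open>LIMSEQ_offset\<close> removes it at the
        end.\<close>
      have lim: "(\<lambda>i. \<integral>w. ?q (h (i + k)) w \<partial>Q) \<longlonglongrightarrow> ?D"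
      proof (rule integral_dominated_convergence[where w = ?g])
        show "AE w in Q. (\<lambda>i. ?q (h (i + k)) w) \<longlonglongrightarrow> complex_of_real w * exp (z * complex_of_real w)"
        proof (rule AE_I2)
          fix w :: real
          have "((\<lambda>x. exp (x * complex_of_real w)) has_field_derivative
                  complex_of_real w * exp (z * complex_of_real w)) (at z)"
            by (auto intro!: derivative_eq_intros)
          hence "((\<lambda>h. ?q h w) \<longlongrightarrow> complex_of_real w * exp (z * complex_of_real w)) (at 0)"
            by (simp add: DERIV_def)
          moreover have "filterlim (\<lambda>i. h (i + k)) (at 0) sequentially"
            using h0 hnz by (auto simp: filterlim_at LIMSEQ_ignore_initial_segment)
          ultimately show "(\<lambda>i. ?q (h (i + k)) w) \<longlonglongrightarrow> complex_of_real w * exp (z * complex_of_real w)"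
            by (rule filterlim_compose)
        qed
        show "AE w in Q. cmod (?q (h (i + k)) w) \<le> ?g w" for i
        proof (rule AE_I2)
          fix w :: real
          let ?h = "h (i + k)"
          have "exp ((z + ?h) * complex_of_real w) - exp (z * complex_of_real w)
                 = exp (z * of_real w) * (exp (?h * of_real w) - 1)"
            by (simp add: algebra_simps exp_add)
          hence "cmod (?q ?h w) = exp (Re z * w) * cmod (exp (?h * of_real w) - 1) / cmod ?h"
            by (simp add: norm_mult norm_divide)
          also have "\<dots> \<le> cmod ?h * ?g w / cmod ?h"
            using exp_times_cmod_exp_minus_one_le[OF \<delta>, of ?h "Re z" w] k[of "i + k"]
            by (intro divide_right_mono) auto
          also have "\<dots> = ?g w" using hnz by simp
          finally show "cmod (?q ?h w) \<le> ?g w" .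
        qed
      qed (use gint in measurable)
      have eq: "(\<integral>w. ?q (h (i + k)) w \<partial>Q) = (?F (z + h (i + k)) - ?F z) / h (i + k)" for i
      proof -
        have "Re (z + h (i + k)) \<in> \<Theta>"
          using inT[of "Re (h (i + k))"] k[of "i + k"] abs_Re_le_cmod[of "h (i + k)"] \<delta> by simp
        hence "integrable Q (\<lambda>w. exp ((z + h (i + k)) * complex_of_real w))"
          by (intro integrable_complex_exp Q int)
        moreover have "integrable Q (\<lambda>w. exp (z * complex_of_real w))"
          using z by (intro integrable_complex_exp Q int)
        ultimately show ?thesis by (simp add: Bochner_Integration.integral_diff)
      qed
      from lim have "(\<lambda>i. (?F (z + h (i + k)) - ?F z) / h (i + k)) \<longlonglongrightarrow> ?D"
        unfolding eq .
      thus "(\<lambda>i. (?F (z + h i) - ?F z) / h i) \<longlonglongrightarrow> ?D"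
        by (rule LIMSEQ_offset)
    qed
    hence "(?F has_field_derivative ?D) (at z)" by (simp add: DERIV_def)
    thus "\<exists>f'. (?F has_field_derivative f') (at z)" by blast
  qed
qed

text \<open>
  The order of a zero of \<open>f\<close> would be divisible by every \<open>n\<close>, hence arbitrarily large.
\<close>

lemma holomorphic_nonzero_of_nth_roots:
  fixes f :: "complex \<Rightarrow> complex" and g :: "nat \<Rightarrow> complex \<Rightarrow> complex"
  assumes f: "f holomorphic_on S" "open S" "connected S" "z0 \<in> S" "f z0 \<noteq> 0"
    and g: "\<And>n. 0 < n \<Longrightarrow> g n holomorphic_on S"
    and fg: "\<And>n z. 0 < n \<Longrightarrow> z \<in> S \<Longrightarrow> f z = g n z ^ n"
    and "z \<in> S"
  shows "f z \<noteq> 0"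
proof
  assume fz: "f z = 0"
  have "\<exists>w\<in>S. f w \<noteq> 0" using f by blast
  note ze = zorder_exist_zero[OF f(1-3) \<open>z \<in> S\<close> this]
  have pos: "zorder f z > 0" using ze fz by simp
  \<comment> \<open>An \<open>n\<close> above the order of \<open>f\<close> at \<open>z\<close>
    suffices: the order of \<open>f\<close> is \<open>n\<close> times that of \<open>g n\<close>,
    and the latter is at least 1.\<close>
  define n where "n = Suc (nat (zorder f z))"
  have n: "0 < n" "int n > zorder f z" by (auto simp: n_def)
  have "\<not> (\<forall>w\<in>S. g n w = 0)" using fg[OF n(1) f(4)] f(5) f(4) n by auto
  hence gn0: "\<exists>w\<in>S. g n w \<noteq> 0" by blast
  note zg = zorder_exist_zero[OF g[OF n(1)] f(2,3) \<open>z \<in> S\<close> gn0]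
  have gz: "g n z = 0" using fg[OF n(1) \<open>z \<in> S\<close>] fz by simp
  hence zgpos: "zorder (g n) z > 0" using zg by simp
  have an: "g n analytic_on {z}" using g[OF n(1)] f(2) \<open>z \<in> S\<close> analytic_at by blast
  from gn0 obtain \<beta> where "\<beta> \<in> S" "g n \<beta> \<noteq> 0" by blast
  from non_zero_neighbour_alt[OF g[OF n(1)] f(2,3) \<open>z \<in> S\<close> this]
  have "\<forall>\<^sub>F w in at z. g n w \<noteq> 0" by (rule eventually_mono) simp
  hence "\<exists>\<^sub>F w in at z. g n w \<noteq> 0" by (intro eventually_frequently) auto
  hence "zorder (\<lambda>w. g n w ^ n) z = n * zorder (g n) z"
    using an by (intro zorder_power analytic_on_imp_meromorphic_on)
  moreover have "zorder f z = zorder (\<lambda>w. g n w ^ n) z"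
  proof (rule zorder_cong)
    show "\<forall>\<^sub>F w in at z. f w = g n w ^ n"
      using eventually_at_in_open'[OF f(2) \<open>z \<in> S\<close>] by eventually_elim (rule fg[OF n(1)])
  qed simp
  moreover have "int n * zorder (g n) z \<ge> int n * 1" using zgpos by (intro mult_left_mono) auto
  ultimately show False using n(2) by linarith
qed

text \<open>The strip is convex, hence connected, and the real points of the open set \<Theta>
  accumulate at \<open>\<theta>0\<close>. The difference of \<open>f\<close> and \<open>g\<close>
  therefore vanishes throughout.\<close>

lemma identity_on_strip:
  assumes \<Theta>: "open \<Theta>" "is_interval \<Theta>" "\<theta>0 \<in> \<Theta>"
    and f: "f holomorphic_on {z. Re z \<in> \<Theta>}" and g: "g holomorphic_on {z. Re z \<in> \<Theta>}"
    and eq: "\<And>\<theta>. \<theta> \<in> \<Theta> \<Longrightarrow> f (complex_of_real \<theta>) = g (complex_of_real \<theta>)"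
    and z: "Re z \<in> \<Theta>"
  shows "f z = g z"
proof -
  have "f z - g z = 0"
  proof (rule analytic_continuation[where f = "\<lambda>z. f z - g z" and S = "{z. Re z \<in> \<Theta>}" 
        and U = "complex_of_real ` \<Theta>" and \<xi> = "complex_of_real \<theta>0"])
    show "connected {z. Re z \<in> \<Theta>}" using convex_strip[OF \<Theta>(2)] by (rule convex_connected)
    show "complex_of_real \<theta>0 islimpt complex_of_real ` \<Theta>"
    proof -
      have "\<theta>0 islimpt \<Theta>" using \<Theta> interior_limit_point interior_open by blast
      then obtain s where s: "\<And>n. s n \<in> \<Theta> - {\<theta>0}" "s \<longlonglongrightarrow> \<theta>0"
        unfolding islimpt_sequential by blast
      show ?thesis unfolding islimpt_sequential
        by (rule exI[of _ "\<lambda>n. complex_of_real (s n)"]) (use s in \<open>auto intro: tendsto_of_real\<close>)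
    qed
  qed (use assms open_strip[OF \<Theta>(1)] in \<open>auto intro!: holomorphic_intros\<close>)
  thus ?thesis by simp
qed

section \<open>The cumulant function at complex arguments\<close>

text \<open>The values of \<open>D\<close> are integer multiples of \<open>2 * pi * \<i>\<close>, so
  distinct ones are at least \<open>2 * pi\<close> apart, and a continuous function with such a
  range is constant on a connected set. This serves to compare two logarithms of one
  function.\<close>

lemma continuous_log_unity_constant:
  fixes D :: "real \<Rightarrow> complex"
  assumes "connected S" "continuous_on S D" and D: "\<And>x. x \<in> S \<Longrightarrow> exp (D x) = 1"
  obtains k where "\<And>x. x \<in> S \<Longrightarrow> D x = k" 
proof -
  have "D constant_on S"
  proof (rule continuous_discrete_range_constant[OF assms(1,2)])
    fix x assume x: "x \<in> S"
    show "\<exists>e>0. \<forall>y. y \<in> S \<and> D y \<noteq> D x \<longrightarrow> e \<le> cmod (D y - D x)"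
    proof (intro exI[of _ "2 * pi"] conjI allI impI)
      fix y assume y: "y \<in> S \<and> D y \<noteq> D x"
      from D[OF x] obtain m :: int where m: "Re (D x) = 0" "Im (D x) = of_int (2 * m) * pi"
        unfolding exp_eq_1 by blast
      from D[of y] y obtain n :: int where n: "Re (D y) = 0" "Im (D y) = of_int (2 * n) * pi"
        unfolding exp_eq_1 by blast
      have "n \<noteq> m" using m n y by (auto simp: complex_eq_iff)
      hence "1 \<le> \<bar>real_of_int (n - m)\<bar>" by linarith
      hence "2 * pi * 1 \<le> 2 * pi * \<bar>real_of_int (n - m)\<bar>" by (intro mult_left_mono) auto
      also have "\<dots> = \<bar>Im (D y - D x)\<bar>"
      proof -
        have "Im (D y - D x) = 2 * pi * real_of_int (n - m)" by (simp add: m n algebra_simps)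
        thus ?thesis by (simp add: abs_mult)
      qed
      also have "\<dots> \<le> cmod (D y - D x)" by (rule abs_Im_le_cmod)
      finally show "2 * pi \<le> cmod (D y - D x)" by simp
    qed auto
  qed
  thus ?thesis using that unfolding constant_on_def by blast
qed

section \<open>The transform of the exponential family and the complex cumulant function\<close>

context exponential_family
begin

definition ef_law :: "real \<Rightarrow> real measure" where
  "ef_law \<phi> = density \<nu> (\<lambda>w. ennreal (ef_density b c \<phi> \<xi>0 w))"

text \<open>
  The centring at \<open>\<xi>0\<close> removes \<open>c\<close>: on \<open>\<Theta>\<close> the value is \<open>exp (\<phi> * (b \<theta> - b \<xi>0))\<close>.
\<close>

definition ef_laplace :: "real \<Rightarrow> complex \<Rightarrow> complex" where
  "ef_laplace \<phi> z =
     (\<integral>w. exp (complex_of_real \<phi> * (z - complex_of_real \<xi>0) * complex_of_real w) \<partial>ef_law \<phi>)"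

lemma xi0_in_Theta: "\<xi>0 \<in> \<Theta>"
  using Theta_lower by auto

lemma sets_ef_law [measurable_cong, simp]: "sets (ef_law \<phi>) = sets borel"
  by (simp add: ef_law_def sets_nu)

text \<open>Exponential tilting: multiplying the density at \<xi>0 by the exponential gives the
  density at \<theta> up to the constant \<open>exp (\<phi> * (b \<theta> - b \<xi>0))\<close>, and
  the density at \<theta> has total mass 1.\<close>

lemma
  assumes \<phi>: "0 < \<phi>" and \<theta>: "\<theta> \<in> \<Theta>"
  shows integrable_ef_law_exp: "integrable (ef_law \<phi>) (\<lambda>w. exp (\<phi> * (\<theta> - \<xi>0) * w))"
    and integral_ef_law_exp:
      "(\<integral>w. exp (\<phi> * (\<theta> - \<xi>0) * w) \<partial>ef_law \<phi>) = exp (\<phi> * (b \<theta> - b \<xi>0))"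
proof -
  have [measurable_cong]: "sets \<nu> = sets borel" by (rule sets_nu)
  have [measurable]: "ef_density b c \<phi> \<xi>0 \<in> borel_measurable \<nu>" "ef_density b c \<phi> \<theta> \<in> borel_measurable \<nu>"
    using density_measurable \<phi> \<theta> xi0_in_Theta by auto
  have "(\<integral>\<^sup>+w. ennreal (exp (\<phi> * (\<theta> - \<xi>0) * w)) \<partial>ef_law \<phi>)
     = (\<integral>\<^sup>+w. ennreal (ef_density b c \<phi> \<xi>0 w) * ennreal (exp (\<phi> * (\<theta> - \<xi>0) * w)) \<partial>\<nu>)"
    unfolding ef_law_def by (subst nn_integral_density) auto
  also have "\<dots> = (\<integral>\<^sup>+w. ennreal (exp (\<phi> * (b \<theta> - b \<xi>0))) * ennreal (ef_density b c \<phi> \<theta> w) \<partial>\<nu>)"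
    by (intro nn_integral_cong)
       (auto simp: ef_density_def ennreal_mult'[symmetric] exp_add[symmetric] algebra_simps)
  also have "\<dots> = ennreal (exp (\<phi> * (b \<theta> - b \<xi>0)))"
    using density_total[OF \<phi> \<theta>] by (subst nn_integral_cmult) auto
  finally have "(\<integral>\<^sup>+w. ennreal (exp (\<phi> * (\<theta> - \<xi>0) * w)) \<partial>ef_law \<phi>) = ennreal (exp (\<phi> * (b \<theta> - b \<xi>0)))" .
  hence "integrable (ef_law \<phi>) (\<lambda>w. exp (\<phi> * (\<theta> - \<xi>0) * w)) \<and>
    (\<integral>w. exp (\<phi> * (\<theta> - \<xi>0) * w) \<partial>ef_law \<phi>) = exp (\<phi> * (b \<theta> - b \<xi>0))"
    by (subst (asm) nn_integral_eq_integrable) auto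
  thus "integrable (ef_law \<phi>) (\<lambda>w. exp (\<phi> * (\<theta> - \<xi>0) * w))"
    "(\<integral>w. exp (\<phi> * (\<theta> - \<xi>0) * w) \<partial>ef_law \<phi>) = exp (\<phi> * (b \<theta> - b \<xi>0))" by auto
qed

lemma ef_laplace_of_real:
  assumes "0 < \<phi>" "\<theta> \<in> \<Theta>"
  shows "ef_laplace \<phi> (complex_of_real \<theta>) = complex_of_real (exp (\<phi> * (b \<theta> - b \<xi>0)))"
proof -
  have "ef_laplace \<phi> (complex_of_real \<theta>) =
      (\<integral>w. complex_of_real (exp (\<phi> * (\<theta> - \<xi>0) * w)) \<partial>ef_law \<phi>)"
    unfolding ef_laplace_def by (simp add: exp_of_real[symmetric])
  thus ?thesis using integral_ef_law_exp[OF assms] by simp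
qed

lemma ef_laplace_holomorphic:
  assumes \<phi>: "0 < \<phi>"
  shows "ef_laplace \<phi> holomorphic_on {z. Re z \<in> \<Theta>}"
proof -
  \<comment> \<open>\<open>T\<close> is the range of the real variable
    \<open>s = \<phi> * (\<theta> - \<xi>0)\<close> as \<theta> runs through \<Theta>; the general
    result on Laplace transforms is applied there and then composed with this affine map.\<close>
  define T where "T = (\<lambda>s. \<xi>0 + s / \<phi>) -` \<Theta>"
  have "(\<lambda>z. \<integral>w. exp (z * complex_of_real w) \<partial>ef_law \<phi>) holomorphic_on {z. Re z \<in> T}"
  proof (rule laplace_transform_holomorphic)
    show "open T" unfolding T_def using \<phi> by (intro open_vimage open_Theta continuous_intros) auto
    show "integrable (ef_law \<phi>) (\<lambda>w. exp (s * w))" if "s \<in> T" for s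
      using integrable_ef_law_exp[OF \<phi>, of "\<xi>0 + s / \<phi>"] that \<phi> by (simp add: T_def)
  qed simp
  hence "((\<lambda>z. \<integral>w. exp (z * complex_of_real w) \<partial>ef_law \<phi>) \<circ>
      (\<lambda>z. complex_of_real \<phi> * (z - complex_of_real \<xi>0))) holomorphic_on {z. Re z \<in> \<Theta>}"
    using \<phi> by (intro holomorphic_on_compose_gen[of _ _ _ "{z. Re z \<in> T}"])
               (auto intro!: holomorphic_intros simp: T_def)
  thus ?thesis by (simp add: comp_def ef_laplace_def[abs_def])
qed

text \<open>On real arguments this is \<open>exp (b \<theta> - b \<xi>0) = exp ((b \<theta> - b
  \<xi>0) / n) ^ n\<close>, because the same \<open>b\<close> serves every dispersion parameter. The
  identity theorem carries it to the strip.\<close>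

lemma ef_laplace_power:
  assumes "0 < n" "Re z \<in> \<Theta>"
  shows "ef_laplace 1 z = ef_laplace (1 / real n) z ^ n"
proof (rule identity_on_strip[OF open_Theta interval_Theta xi0_in_Theta _ _ _ assms(2)])
  show "ef_laplace 1 (complex_of_real \<theta>) = ef_laplace (1 / real n) (complex_of_real \<theta>) ^ n"
    if "\<theta> \<in> \<Theta>" for \<theta>
    using that assms(1) by (simp add: ef_laplace_of_real flip: of_real_power exp_of_nat_mult)
qed (use assms in \<open>auto intro!: holomorphic_intros ef_laplace_holomorphic\<close>)

lemma ef_laplace_nonzero:
  assumes "Re z \<in> \<Theta>"
  shows "ef_laplace 1 z \<noteq> 0"
proof (rule holomorphic_nonzero_of_nth_roots[where f = "ef_laplace 1" and S = "{z. Re z \<in> \<Theta>}"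
        and g = "\<lambda>n. ef_laplace (1 / real n)" and ?z0.0 = "complex_of_real \<xi>0"])
  show "ef_laplace 1 (complex_of_real \<xi>0) \<noteq> 0"
    using ef_laplace_of_real[of 1 \<xi>0] xi0_in_Theta by simp
  show "connected {z. Re z \<in> \<Theta>}" "open {z. Re z \<in> \<Theta>}"
    using convex_strip[OF interval_Theta] convex_connected open_strip[OF open_Theta] by auto
qed (use assms xi0_in_Theta ef_laplace_holomorphic ef_laplace_power in auto)

text \<open>This makes the choice in \<open>analytic_extension\<close> meaningful. The strip is
  contractible and the transform has no zeros on it, so a holomorphic logarithm exists; it only has
  to be normalised by a constant.\<close>

lemma cumulant_extension_exists:
  "\<exists>B. B holomorphic_on {z. Re z \<in> \<Theta>} \<and> (\<forall>\<theta>\<in>\<Theta>. B (complex_of_real \<theta>) = complex_of_real (b \<theta>))"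
proof -
  obtain G where G: "G holomorphic_on {z. Re z \<in> \<Theta>}"
      and exp_G: "\<And>z. z \<in> {z. Re z \<in> \<Theta>} \<Longrightarrow> ef_laplace 1 z = exp (G z)"
  proof (rule contractible_imp_holomorphic_log[of "ef_laplace 1" "{z. Re z \<in> \<Theta>}"])
    show "contractible {z. Re z \<in> \<Theta>}"
      using convex_strip[OF interval_Theta] by (rule convex_imp_contractible)
  qed (use ef_laplace_nonzero in \<open>auto intro!: ef_laplace_holomorphic\<close>)
  \<comment> \<open>On \<Theta> both \<open>G\<close> and \<open>b \<theta> - b \<xi>0\<close> are
    continuous logarithms of the transform, hence differ by a constant \<open>k\<close>. Subtracting
    \<open>k\<close> and restoring \<open>b \<xi>0\<close> gives the extension.\<close>
  obtain k where k: "\<And>\<theta>. \<theta> \<in> \<Theta> \<Longrightarrow> G (complex_of_real \<theta>) - complex_of_real (b \<theta> - b \<xi>0) = k"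
  proof (rule continuous_log_unity_constant[of \<Theta> "\<lambda>\<theta>. G (complex_of_real \<theta>) - complex_of_real (b \<theta> - b \<xi>0)"])
    show "connected \<Theta>" using interval_Theta by (rule is_interval_connected)
    have "continuous_on \<Theta> (\<lambda>\<theta>. G (complex_of_real \<theta>))"
      by (rule continuous_on_compose2[OF holomorphic_on_imp_continuous_on[OF G]])
         (auto intro!: continuous_intros)
    thus "continuous_on \<Theta> (\<lambda>\<theta>. G (complex_of_real \<theta>) - complex_of_real (b \<theta> - b \<xi>0))"
      by (intro continuous_intros b_continuous)
    show "exp (G (complex_of_real \<theta>) - complex_of_real (b \<theta> - b \<xi>0)) = 1" if "\<theta> \<in> \<Theta>" for \<theta>
      using exp_G[of "complex_of_real \<theta>"] ef_laplace_of_real[of 1 \<theta>] that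
      by (simp add: exp_diff exp_of_real flip: of_real_diff)
  qed blast
  show ?thesis
  proof (intro exI[of _ "\<lambda>z. G z - k + complex_of_real (b \<xi>0)"] conjI ballI)
    show "G (complex_of_real \<theta>) - k + complex_of_real (b \<xi>0) = complex_of_real (b \<theta>)" if "\<theta> \<in> \<Theta>" for \<theta>
      using k[OF that] by (auto simp: algebra_simps)
  qed (use G in \<open>auto intro!: holomorphic_intros\<close>)
qed

lemma
  shows analytic_extension_holomorphic: "analytic_extension \<Theta> b holomorphic_on {z. Re z \<in> \<Theta>}"
    and analytic_extension_of_real:
      "\<And>\<theta>. \<theta> \<in> \<Theta> \<Longrightarrow> analytic_extension \<Theta> b (complex_of_real \<theta>) = complex_of_real (b \<theta>)"
  using someI_ex[OF cumulant_extension_exists] unfolding analytic_extension_def by blast+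

text \<open>Both sides are holomorphic and agree on \<Theta>. One extension of \<open>b\<close> thus
  serves every \<phi>, and no branch of a complex power has to be chosen.\<close>

lemma ef_laplace_eq:
  assumes \<phi>: "0 < \<phi>" and z: "Re z \<in> \<Theta>"
  shows "ef_laplace \<phi> z = exp (complex_of_real \<phi> *
           (analytic_extension \<Theta> b z - analytic_extension \<Theta> b (complex_of_real \<xi>0)))"
proof (rule identity_on_strip[OF open_Theta interval_Theta xi0_in_Theta _ _ _ z])
  show "ef_laplace \<phi> holomorphic_on {z. Re z \<in> \<Theta>}" using \<phi> by (rule ef_laplace_holomorphic)
  show "(\<lambda>z. exp (complex_of_real \<phi> * (analytic_extension \<Theta> b z -
          analytic_extension \<Theta> b (complex_of_real \<xi>0)))) holomorphic_on {z. Re z \<in> \<Theta>}"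
    by (intro holomorphic_intros analytic_extension_holomorphic)
  show "ef_laplace \<phi> (complex_of_real \<theta>) = exp (complex_of_real \<phi> *
          (analytic_extension \<Theta> b (complex_of_real \<theta>) - analytic_extension \<Theta> b (complex_of_real \<xi>0)))"
    if "\<theta> \<in> \<Theta>" for \<theta>
    unfolding ef_laplace_of_real[OF \<phi> that] analytic_extension_of_real[OF that]
      analytic_extension_of_real[OF xi0_in_Theta] by (simp add: exp_of_real[symmetric])
qed

text \<open>Substituting \<open>z = \<xi>0 + s / \<phi>\<close> turns the centred transform into the
  plain one; the assumption on \<open>s\<close> places \<open>z\<close> in the strip.\<close>

lemma ef_law_complex_exp:
  assumes \<phi>: "0 < \<phi>" and s: "\<xi>0 + Re s / \<phi> \<in> \<Theta>"
  shows "(\<integral>w. exp (s * complex_of_real w) \<partial>ef_law \<phi>) =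
           exp (- (complex_of_real \<phi> * (analytic_extension \<Theta> b (complex_of_real \<xi>0) -
             analytic_extension \<Theta> b (complex_of_real \<xi>0 + inverse (complex_of_real \<phi>) * s))))"
proof -
  let ?z = "complex_of_real \<xi>0 + inverse (complex_of_real \<phi>) * s"
  have z: "Re ?z = \<xi>0 + Re s / \<phi>"
    by (simp add: divide_inverse mult.commute flip: of_real_inverse)
  have "complex_of_real \<phi> * (?z - complex_of_real \<xi>0) = s" using \<phi> by simp
  hence "(\<integral>w. exp (s * complex_of_real w) \<partial>ef_law \<phi>) = ef_laplace \<phi> ?z"
    unfolding ef_laplace_def by metis
  thus ?thesis using ef_laplace_eq[OF \<phi>, of ?z] s unfolding z by (simp add: right_diff_distrib)
qed

end

section \<open>Compound mixed Poisson sums\<close>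

context prob_space
begin

text \<open>The \<sigma>-algebra generated by a function of \<open>A\<close> lies inside the one
  generated by \<open>A\<close>, and likewise for \<open>B\<close>. With \<open>f\<close> and
  \<open>g\<close> mapping to a common type, the product rule for expectations becomes
  available.\<close>

lemma indep_rv_indep_var:
  assumes "indep_rv M Ma A Mb B" and f: "f \<in> measurable Ma S" and g: "g \<in> measurable Mb T"
  shows "indep_var S (\<lambda>\<omega>. f (A \<omega>)) T (\<lambda>\<omega>. g (B \<omega>))"
proof -
  from assms(1) have A: "A \<in> measurable M Ma" and B: "B \<in> measurable M Mb"
    and ind: "indep_set (sets (vimage_algebra (space M) A Ma)) (sets (vimage_algebra (space M) B Mb))"
    unfolding indep_rv_def by auto
  have sub: "sigma_sets (space M) {(\<lambda>\<omega>. h (C \<omega>)) -` E \<inter> space M |E. E \<in> sets U}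
               \<subseteq> sets (vimage_algebra (space M) C K)"
    if "C \<in> measurable M K" "h \<in> measurable K U" for C K h U
  proof -
    have "(\<lambda>\<omega>. h (C \<omega>)) -` E \<inter> space M \<in> sets (vimage_algebra (space M) C K)" if E: "E \<in> sets U" for E
    proof -
      have "h -` E \<inter> space K \<in> sets K" using \<open>h \<in> measurable K U\<close> E by (rule measurable_sets)
      hence "C -` (h -` E \<inter> space K) \<inter> space M \<in> sets (vimage_algebra (space M) C K)"
        by (rule in_vimage_algebra)
      also have "C -` (h -` E \<inter> space K) \<inter> space M = (\<lambda>\<omega>. h (C \<omega>)) -` E \<inter> space M"
        using measurable_space[OF \<open>C \<in> measurable M K\<close>] by auto
      finally show ?thesis .
    qed
    hence "{(\<lambda>\<omega>. h (C \<omega>)) -` E \<inter> space M |E. E \<in> sets U} \<subseteq> sets (vimage_algebra (space M) C K)"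
      by auto
    from sets.sigma_sets_subset[OF this] show ?thesis by simp
  qed
  have "indep_set (sigma_sets (space M) {(\<lambda>\<omega>. f (A \<omega>)) -` E \<inter> space M |E. E \<in> sets S})
          (sigma_sets (space M) {(\<lambda>\<omega>. g (B \<omega>)) -` E \<inter> space M |E. E \<in> sets T})"
    using ind unfolding indep_set_def
    by (rule indep_sets_mono_sets) (use sub[OF A f] sub[OF B g] in \<open>auto split: bool.splits\<close>)
  thus ?thesis unfolding indep_var_eq using A B f g by auto
qed

text \<open>Integrating the conditional probabilities gives \<open>P(N = k)\<close> as the mean of a
  Poisson weight. Summing these weights against \<open>z ^ k\<close> under the integral produces the
  exponential series.\<close>

lemma mixed_poisson_pgf:
  assumes mp: "mixed_poisson M l W N" and l: "0 < l" and W: "AE \<omega> in M. 0 < W \<omega>"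
    and z: "cmod z \<le> 1"
  shows "(\<lambda>k. z ^ k * complex_of_real (prob {\<omega> \<in> space M. N \<omega> = k})) sums
           (\<integral>\<omega>. exp (complex_of_real l * (z - 1) * complex_of_real (W \<omega>)) \<partial>M)"
proof -
  from mp have Wm [measurable]: "W \<in> borel_measurable M"
    and Nm [measurable]: "N \<in> measurable M (count_space UNIV)"
    and ce: "\<And>k. AE \<omega> in M.
        real_cond_exp M (vimage_algebra (space M) W borel) (indicator {\<omega> \<in> space M. N \<omega> = k}) \<omega>
          = pmf (poisson_pmf (l * W \<omega>)) k"
    unfolding mixed_poisson_def by auto
  \<comment> \<open>The Poisson weight as an explicit formula: it is measurable in \<omega> and its
    series converges for every \<omega>, while it agrees with the mass function only where
    \<open>W\<close> is positive, that is almost everywhere.\<close>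
  define p where "p k \<omega> = (l * W \<omega>) ^ k / fact k * exp (- (l * W \<omega>))" for k \<omega>
  have pm [measurable]: "p k \<in> borel_measurable M" for k unfolding p_def by measurable
  have sub: "subalgebra M (vimage_algebra (space M) W borel)"
    unfolding subalgebra_def using Wm by (auto simp: sets_vimage_algebra2 measurable_sets)
  interpret V: finite_measure_subalgebra M "vimage_algebra (space M) W borel"
    by unfold_locales (rule sub)
  have pos: "AE \<omega> in M. \<forall>k. 0 \<le> p k \<omega>"
    using W by eventually_elim (use l in \<open>auto simp: p_def\<close>)
  have ind_int: "integrable M (indicator {\<omega> \<in> space M. N \<omega> = k} :: 'a \<Rightarrow> real)" for k
    by (intro integrable_real_indicator) (auto simp: less_top[symmetric])
  have pAE: "AE \<omega> in M. real_cond_exp M (vimage_algebra (space M) W borel)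
      (indicator {\<omega> \<in> space M. N \<omega> = k}) \<omega> = p k \<omega>" for k
    using ce[of k] W by eventually_elim (use l in \<open>simp add: p_def\<close>)
  have p_int: "integrable M (p k)" for k
    by (rule integrable_cong_AE_imp[OF V.real_cond_exp_int(1)[OF ind_int[of k]] pm])
       (use pAE[of k] in eventually_elim, simp)
  have p_prob: "(\<integral>\<omega>. p k \<omega> \<partial>M) = prob {\<omega> \<in> space M. N \<omega> = k}" for k
  proof -
    have "(\<integral>\<omega>. p k \<omega> \<partial>M) = (\<integral>\<omega>. real_cond_exp M (vimage_algebra (space M) W borel)
            (indicator {\<omega> \<in> space M. N \<omega> = k}) \<omega> \<partial>M)"
    proof (rule integral_cong_AE[OF pm])
      show "real_cond_exp M (vimage_algebra (space M) W borel) (indicator {\<omega> \<in> space M. N \<omega> = k})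
          \<in> borel_measurable M" by (rule borel_measurable_cond_exp2)
      show "AE \<omega> in M. p k \<omega> = real_cond_exp M (vimage_algebra (space M) W borel)
            (indicator {\<omega> \<in> space M. N \<omega> = k}) \<omega>"
        using pAE[of k] by eventually_elim simp
    qed
    also have "\<dots> = (\<integral>\<omega>. indicator {\<omega> \<in> space M. N \<omega> = k} \<omega> \<partial>M)"
      by (rule V.real_cond_exp_int(2)[OF ind_int])
    also have "\<dots> = prob {\<omega> \<in> space M. N \<omega> = k}" by simp
    finally show ?thesis .
  qed
  have sum_prob: "summable (\<lambda>k. prob {\<omega> \<in> space M. N \<omega> = k})"
  proof -
    have "(\<lambda>k. prob {\<omega> \<in> space M. N \<omega> = k}) sums prob (\<Union>k. {\<omega> \<in> space M. N \<omega> = k})"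
      by (rule finite_measure_UNION) (auto simp: disjoint_family_on_def)
    thus ?thesis by (rule sums_summable)
  qed
  have zk: "cmod (z ^ k * complex_of_real x) \<le> \<bar>x\<bar>" for k x
    using z by (simp add: norm_mult norm_power mult_left_le_one_le power_le_one)
  have p_sums: "(\<lambda>k. z ^ k * complex_of_real (p k \<omega>)) sums
      exp (complex_of_real l * (z - 1) * complex_of_real (W \<omega>))" for \<omega>
  proof -
    have "(\<lambda>k. (z * complex_of_real (l * W \<omega>)) ^ k /\<^sub>R fact k) sums exp (z * complex_of_real (l * W \<omega>))"
      by (rule exp_converges)
    hence "(\<lambda>k. (z * complex_of_real (l * W \<omega>)) ^ k /\<^sub>R fact k * exp (- complex_of_real (l * W \<omega>))) sums
        (exp (z * complex_of_real (l * W \<omega>)) * exp (- complex_of_real (l * W \<omega>)))"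
      by (rule sums_mult2)
    also have "(\<lambda>k. (z * complex_of_real (l * W \<omega>)) ^ k /\<^sub>R fact k * exp (- complex_of_real (l * W \<omega>)))
        = (\<lambda>k. z ^ k * complex_of_real (p k \<omega>))"
      by (auto simp: p_def scaleR_conv_of_real power_mult_distrib exp_of_real[symmetric] field_simps fun_eq_iff)
    also have "exp (z * complex_of_real (l * W \<omega>)) * exp (- complex_of_real (l * W \<omega>))
        = exp (complex_of_real l * (z - 1) * complex_of_real (W \<omega>))"
      by (simp add: exp_add[symmetric] algebra_simps)
    finally show ?thesis .
  qed
  \<comment> \<open>Sum and integral may be exchanged since, by \<open>cmod z \<le> 1\<close>, the
    \<open>k\<close>-th term is dominated by \<open>p k\<close>, whose integral
    \<open>P(N = k)\<close> is summable.\<close>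
  have "(\<lambda>k. \<integral>\<omega>. z ^ k * complex_of_real (p k \<omega>) \<partial>M) sums (\<integral>\<omega>. (\<Sum>k. z ^ k * complex_of_real (p k \<omega>)) \<partial>M)"
  proof (rule sums_integral)
    show "integrable M (\<lambda>\<omega>. z ^ k * complex_of_real (p k \<omega>))" for k
      using p_int by (intro integrable_mult_right integrable_of_real)
    show "AE \<omega> in M. summable (\<lambda>k. cmod (z ^ k * complex_of_real (p k \<omega>)))"
      using pos
    proof eventually_elim
      fix \<omega> assume nn: "\<forall>k. 0 \<le> p k \<omega>"
      have "summable (\<lambda>k. (l * W \<omega>) ^ k /\<^sub>R fact k * exp (- (l * W \<omega>)))"
        by (intro summable_mult2 sums_summable[OF exp_converges])
      hence "summable (\<lambda>k. p k \<omega>)" by (simp add: p_def divide_inverse mult.commute)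
      thus "summable (\<lambda>k. cmod (z ^ k * complex_of_real (p k \<omega>)))"
        by (rule summable_comparison_test[rotated]) (use zk nn in \<open>auto intro!: exI[of _ 0] order_trans[OF zk]\<close>)
    qed
    show "summable (\<lambda>k. \<integral>\<omega>. cmod (z ^ k * complex_of_real (p k \<omega>)) \<partial>M)"
    proof (rule summable_comparison_test[OF _ sum_prob], intro exI[of _ 0] allI impI)
      fix k
      have "(\<integral>\<omega>. cmod (z ^ k * complex_of_real (p k \<omega>)) \<partial>M) \<le> (\<integral>\<omega>. p k \<omega> \<partial>M)"
      proof (rule integral_mono_AE)
        show "integrable M (\<lambda>\<omega>. cmod (z ^ k * complex_of_real (p k \<omega>)))"
          using p_int by (intro integrable_norm integrable_mult_right integrable_of_real)
        show "AE \<omega> in M. cmod (z ^ k * complex_of_real (p k \<omega>)) \<le> p k \<omega>"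
          using pos by eventually_elim (use zk in \<open>metis abs_of_nonneg\<close>)
      qed (rule p_int)
      thus "norm (\<integral>\<omega>. cmod (z ^ k * complex_of_real (p k \<omega>)) \<partial>M) \<le> prob {\<omega> \<in> space M. N \<omega> = k}"
        by (simp add: p_prob integral_nonneg_AE)
    qed
  qed
  thus ?thesis by (simp add: sums_unique[OF p_sums, symmetric] p_prob)
qed

text \<open>Split according to the value of \<open>N\<close>. On the event \<open>N = k\<close> the
  sum has \<open>k\<close> terms, and independence factors the contribution into
  \<open>g ^ k\<close> and the probability of the event.\<close>

lemma char_compound_sum:
  fixes X :: "nat \<Rightarrow> 'a \<Rightarrow> real" and t :: real
  assumes X_indep: "indep_vars (\<lambda>_. borel) X {1..}"
    and X_distr: "\<And>n. n \<ge> 1 \<Longrightarrow> distr M borel (X n) = distr M borel (X 1)"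
    and XN: "indep_rv M (\<Pi>\<^sub>M n\<in>{1..}. borel) (\<lambda>\<omega>. \<lambda>n\<in>{1..}. X n \<omega>) (count_space UNIV) N"
    and f [measurable]: "f \<in> borel_measurable borel"
  defines "g \<equiv> char (distr M borel (\<lambda>\<omega>. f (X 1 \<omega>))) t"
  shows "(\<lambda>k. g ^ k * complex_of_real (prob {\<omega> \<in> space M. N \<omega> = k})) sums
           char (distr M borel (\<lambda>\<omega>. \<Sum>i = 1..N \<omega>. f (X i \<omega>))) t"
proof -
  have Xm: "X i \<in> borel_measurable M" if "i \<ge> 1" for i
    using X_indep that unfolding indep_vars_def2 by auto
  have Nm [measurable]: "N \<in> measurable M (count_space UNIV)" using XN unfolding indep_rv_def by auto
  define T where "T k \<omega> = (\<Sum>i = 1..k. f (X i \<omega>))" for k :: nat and \<omega>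
  have Tm [measurable]: "T k \<in> borel_measurable M" for k
    unfolding T_def by (intro borel_measurable_sum measurable_compose[OF Xm f]) auto
  have charT: "(\<integral>\<omega>. iexp (t * T k \<omega>) \<partial>M) = g ^ k" for k
  proof -
    have "(\<integral>\<omega>. iexp (t * T k \<omega>) \<partial>M) = char (distr M borel (T k)) t"
      by (simp add: char_def integral_distr)
    also have "\<dots> = (\<Prod>i\<in>{1..k}. char (distr M borel (\<lambda>\<omega>. f (X i \<omega>))) t)"
    proof -
      have "indep_vars (\<lambda>_. borel) X {1..k}" by (rule indep_vars_subset[OF X_indep]) auto
      hence "indep_vars (\<lambda>_. borel) (\<lambda>i \<omega>. f (X i \<omega>)) {1..k}"
        by (rule indep_vars_compose2) (rule f)
      from char_distr_sum[OF this] show ?thesis unfolding T_def .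
    qed
    also have "\<dots> = (\<Prod>i\<in>{1..k}. g)"
    proof (rule prod.cong)
      fix i assume i: "i \<in> {1..k}"
      have "distr M borel (\<lambda>\<omega>. f (X i \<omega>)) = distr (distr M borel (X i)) borel f" 
        using Xm[of i] i by (subst distr_distr) (auto simp: comp_def)
      also have "\<dots> = distr (distr M borel (X 1)) borel f" using X_distr[of i] i by (simp only: atLeastAtMost_iff)
      also have "\<dots> = distr M borel (\<lambda>\<omega>. f (X 1 \<omega>))"
        using Xm[of 1] by (subst distr_distr) (auto simp: comp_def)
      finally show "char (distr M borel (\<lambda>\<omega>. f (X i \<omega>))) t = g" by (simp add: g_def)
    qed simp
    finally show ?thesis by simp
  qed
  have summand: "(\<integral>\<omega>. iexp (t * T k \<omega>) * indicator {\<omega> \<in> space M. N \<omega> = k} \<omega> \<partial>M)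
      = g ^ k * complex_of_real (prob {\<omega> \<in> space M. N \<omega> = k})" for k
  proof -
    \<comment> \<open>The sum is written as a function of the whole restricted sequence, the form in
      which \<open>XN\<close> states independence. The indicator is complex-valued so that both
      factors share a type.\<close>
    have "indep_var borel (\<lambda>\<omega>. iexp (t * (\<Sum>i = 1..k. f ((\<lambda>n\<in>{1..}. X n \<omega>) i))))
            borel (\<lambda>\<omega>. indicator {k} (N \<omega>) :: complex)"
    proof (rule indep_rv_indep_var[OF XN])
      show "(\<lambda>x. iexp (t * (\<Sum>i = 1..k. f (x i)))) \<in> borel_measurable (\<Pi>\<^sub>M n\<in>{1..}. borel)"
        by measurable
    qed simp
    also have "(\<lambda>\<omega>. iexp (t * (\<Sum>i = 1..k. f ((\<lambda>n\<in>{1..}. X n \<omega>) i)))) = (\<lambda>\<omega>. iexp (t * T k \<omega>))"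
      by (simp add: T_def)
    finally have iv: "indep_var borel (\<lambda>\<omega>. iexp (t * T k \<omega>)) borel (\<lambda>\<omega>. indicator {k} (N \<omega>) :: complex)" .
    have "(\<integral>\<omega>. iexp (t * T k \<omega>) * indicator {\<omega> \<in> space M. N \<omega> = k} \<omega> \<partial>M)
        = (\<integral>\<omega>. iexp (t * T k \<omega>) * indicator {k} (N \<omega>) \<partial>M)"
      by (intro Bochner_Integration.integral_cong) (auto simp: indicator_def)
    also have "\<dots> = (\<integral>\<omega>. iexp (t * T k \<omega>) \<partial>M) * (\<integral>\<omega>. indicator {k} (N \<omega>) \<partial>M)"
      using iv by (rule indep_var_lebesgue_integral)
        (auto intro!: integrable_const_bound[where B = 1] simp: indicator_def)
    also have "(\<integral>\<omega>. indicator {k} (N \<omega>) \<partial>M)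
        = (\<integral>\<omega>. complex_of_real (indicator {\<omega> \<in> space M. N \<omega> = k} \<omega>) \<partial>M)"
      by (intro Bochner_Integration.integral_cong) (auto simp: indicator_def)
    also have "\<dots> = complex_of_real (prob {\<omega> \<in> space M. N \<omega> = k})"
      unfolding integral_complex_of_real by simp
    finally show ?thesis unfolding charT .
  qed
  let ?h = "\<lambda>k \<omega>. iexp (t * T k \<omega>) * indicator {\<omega> \<in> space M. N \<omega> = k} \<omega>"
  \<comment> \<open>For each \<omega> only the term with index \<open>N \<omega>\<close> is
    nonzero.\<close>
  have h_sums: "(\<lambda>k. ?h k \<omega>) sums iexp (t * T (N \<omega>) \<omega>)" if "\<omega> \<in> space M" for \<omega>
  proof -
    have "(\<lambda>k. ?h k \<omega>) = (\<lambda>k. if k = N \<omega> then iexp (t * T k \<omega>) else 0)"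
      using that by (auto simp: indicator_def)
    thus ?thesis using sums_single[of "N \<omega>" "\<lambda>k. iexp (t * T k \<omega>)"] by simp
  qed
  have "(\<lambda>k. \<integral>\<omega>. ?h k \<omega> \<partial>M) sums (\<integral>\<omega>. (\<Sum>k. ?h k \<omega>) \<partial>M)"
  proof (rule sums_integral)
    show "integrable M (?h k)" for k
      by (rule integrable_const_bound[where B = 1]) (auto simp: norm_mult indicator_def)
    show "AE \<omega> in M. summable (\<lambda>k. cmod (?h k \<omega>))"
    proof (rule AE_I2)
      fix \<omega>
      show "summable (\<lambda>k. cmod (?h k \<omega>))"
        by (rule summable_finite[of "{N \<omega>}"]) (auto simp: indicator_def)
    qed
    have "(\<lambda>k. prob {\<omega> \<in> space M. N \<omega> = k}) sums prob (\<Union>k. {\<omega> \<in> space M. N \<omega> = k})"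
      by (rule finite_measure_UNION) (auto simp: disjoint_family_on_def)
    moreover have "(\<integral>\<omega>. cmod (?h k \<omega>) \<partial>M) = prob {\<omega> \<in> space M. N \<omega> = k}" for k
    proof -
      have "(\<integral>\<omega>. cmod (?h k \<omega>) \<partial>M) = (\<integral>\<omega>. indicator {\<omega> \<in> space M. N \<omega> = k} \<omega> \<partial>M)"
        by (intro Bochner_Integration.integral_cong) (auto simp: norm_mult indicator_def)
      thus ?thesis by simp
    qed
    ultimately show "summable (\<lambda>k. \<integral>\<omega>. cmod (?h k \<omega>) \<partial>M)" by (simp add: sums_summable)
  qed
  also have "(\<integral>\<omega>. (\<Sum>k. ?h k \<omega>) \<partial>M) = (\<integral>\<omega>. iexp (t * T (N \<omega>) \<omega>) \<partial>M)"
    by (intro Bochner_Integration.integral_cong refl sums_unique[OF h_sums, symmetric])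
  also have "\<dots> = char (distr M borel (\<lambda>\<omega>. T (N \<omega>) \<omega>)) t"
  proof -
    have "(\<lambda>\<omega>. T (N \<omega>) \<omega>) \<in> borel_measurable M"
      by (rule measurable_compose_countable[of T]) auto
    thus ?thesis by (simp add: char_def integral_distr)
  qed
  finally show ?thesis unfolding summand unfolding T_def .
qed

end

section \<open>Weak limits\<close>

text \<open>A limit at infinity can be tested along sequences tending to infinity. Each is shifted
  until its terms are positive, where \<open>\<mu>s\<close> is known to be a distribution, and
  Levy's theorem for sequences applies.\<close>

lemma levy_continuity_at_top:
  fixes \<mu>s :: "real \<Rightarrow> real measure"
  assumes rd: "\<And>l. 0 < l \<Longrightarrow> real_distribution (\<mu>s l)" and Y: "real_distribution Y"
    and char: "\<And>t. ((\<lambda>l. char (\<mu>s l) t) \<longlongrightarrow> char Y t) at_top"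
  shows "weak_conv_filter \<mu>s Y at_top"
  unfolding weak_conv_filter_def
proof (intro allI impI)
  fix x assume x: "isCont (cdf Y) x"
  show "((\<lambda>l. cdf (\<mu>s l) x) \<longlongrightarrow> cdf Y x) at_top"
  proof (rule tendsto_at_topI_sequentially)
    fix l :: "nat \<Rightarrow> real" assume l: "filterlim l at_top sequentially"
    hence "\<forall>\<^sub>F n in sequentially. 0 < l n" by (simp add: filterlim_at_top_dense)
    then obtain k where k: "\<And>n. k \<le> n \<Longrightarrow> 0 < l n" unfolding eventually_sequentially by blast
    have l': "filterlim (\<lambda>n. l (n + k)) at_top sequentially"
      by (rule filterlim_compose[OF l filterlim_add_const_nat_at_top])
    have "weak_conv_m (\<lambda>n. \<mu>s (l (n + k))) Y"
      by (rule levy_continuity) (use rd k Y filterlim_compose[OF char l'] in auto)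
    hence "(\<lambda>n. cdf (\<mu>s (l (n + k))) x) \<longlonglongrightarrow> cdf Y x"
      using x by (simp add: weak_conv_m_def weak_conv_def)
    thus "(\<lambda>n. cdf (\<mu>s (l n)) x) \<longlonglongrightarrow> cdf Y x" by (rule LIMSEQ_offset)
  qed
qed

section \<open>Scaled limits of characteristic functions\<close>

text \<open>The first-order Taylor remainder is at most \<open>(x / l)\<^sup>2 / 2\<close>, which is
  still of order \<open>1 / l\<close> after multiplication by \<open>l\<close>.\<close>

lemma iexp_scaled_limit:
  fixes x :: real
  shows "((\<lambda>l. complex_of_real l * (iexp (x / l) - 1)) \<longlongrightarrow> \<i> * complex_of_real x) at_top"
proof (rule Lim_null[THEN iffD2])
  show "((\<lambda>l. complex_of_real l * (iexp (x / l) - 1) - \<i> * complex_of_real x) \<longlongrightarrow> 0) at_top"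
  proof (rule Lim_null_comparison)
    show "\<forall>\<^sub>F l in at_top. cmod (complex_of_real l * (iexp (x / l) - 1) - \<i> * complex_of_real x) \<le> x\<^sup>2 / 2 / l"
      using eventually_gt_at_top[of 0]
    proof eventually_elim
      fix l :: real assume l: "0 < l"
      have "cmod (iexp (x / l) - (1 + \<i> * complex_of_real (x / l))) \<le> (x / l)\<^sup>2 / 2"
        using iexp_approx1[of "x / l" 1] by (simp add: power2_eq_square)
      hence "l * cmod (iexp (x / l) - (1 + \<i> * complex_of_real (x / l))) \<le> l * ((x / l)\<^sup>2 / 2)"
        using l by (intro mult_left_mono) auto
      also have "l * ((x / l)\<^sup>2 / 2) = x\<^sup>2 / 2 / l" using l by (simp add: power2_eq_square)
      also have "l * cmod (iexp (x / l) - (1 + \<i> * complex_of_real (x / l)))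
          = cmod (complex_of_real l * (iexp (x / l) - (1 + \<i> * complex_of_real (x / l))))"
        using l by (simp add: norm_mult)
      also have "complex_of_real l * (iexp (x / l) - (1 + \<i> * complex_of_real (x / l)))
          = complex_of_real l * (iexp (x / l) - 1) - \<i> * complex_of_real x"
        using l by (simp add: algebra_simps)
      finally show "cmod (complex_of_real l * (iexp (x / l) - 1) - \<i> * complex_of_real x) \<le> x\<^sup>2 / 2 / l"
        .
    qed
    show "((\<lambda>l. x\<^sup>2 / 2 / l) \<longlongrightarrow> 0) at_top"
      by (intro tendsto_divide_0[OF tendsto_const] filterlim_at_top_imp_at_infinity filterlim_ident)
  qed
qed

context prob_space
begin

text \<open>Second-order expansion at \<open>u = t / sqrt l\<close>: since
  \<open>l * u\<^sup>2 = t\<^sup>2\<close>, the quadratic term survives the scaling, and the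
  remainder is \<open>t\<^sup>2 / 6\<close> times an expectation tending to 0.\<close>

lemma centred_char_scaled_limit:
  assumes [measurable]: "Z \<in> borel_measurable M"
    and Z: "integrable M Z" "integrable M (\<lambda>\<omega>. (Z \<omega>)\<^sup>2)" "expectation Z = 0" "variance Z = \<sigma>2"
  shows "((\<lambda>l. complex_of_real l * (char (distr M borel Z) (t / sqrt l) - 1))
            \<longlongrightarrow> complex_of_real (- (t\<^sup>2 * \<sigma>2 / 2))) at_top"
proof (rule Lim_null[THEN iffD2])
  let ?c = "complex_of_real (- (t\<^sup>2 * \<sigma>2 / 2))"
  let ?\<psi> = "char (distr M borel Z)"
  let ?r = "\<lambda>u. expectation (\<lambda>\<omega>. min (6 * (Z \<omega>)\<^sup>2) (\<bar>u\<bar> * \<bar>Z \<omega>\<bar> ^ 3))"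
  show "((\<lambda>l. complex_of_real l * (?\<psi> (t / sqrt l) - 1) - ?c) \<longlongrightarrow> 0) at_top"
  proof (rule Lim_null_comparison)
    show "\<forall>\<^sub>F l in at_top. cmod (complex_of_real l * (?\<psi> (t / sqrt l) - 1) - ?c) \<le> t\<^sup>2 / 6 * ?r (t / sqrt l)"
      using eventually_gt_at_top[of 0]
    proof eventually_elim
      fix l :: real assume l: "0 < l"
      let ?u = "t / sqrt l"
      have u2: "?u\<^sup>2 = t\<^sup>2 / l" using l by (simp add: power_divide)
      have "cmod (?\<psi> ?u - (1 - ?u\<^sup>2 * \<sigma>2 / 2)) \<le> (?u\<^sup>2 / 6) * ?r ?u"
        using char_approx3'[OF assms(1) Z refl, of ?u] by simp
      hence "l * cmod (?\<psi> ?u - (1 - ?u\<^sup>2 * \<sigma>2 / 2)) \<le> l * ((?u\<^sup>2 / 6) * ?r ?u)"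
        using l by (intro mult_left_mono) auto
      also have "l * ((?u\<^sup>2 / 6) * ?r ?u) = t\<^sup>2 / 6 * ?r ?u" unfolding u2 using l by simp
      also have "l * cmod (?\<psi> ?u - (1 - ?u\<^sup>2 * \<sigma>2 / 2))
          = cmod (complex_of_real l * (?\<psi> ?u - (1 - complex_of_real (?u\<^sup>2) * \<sigma>2 / 2)))"
        using l by (simp add: norm_mult)
      also have "complex_of_real l * (?\<psi> ?u - (1 - complex_of_real (?u\<^sup>2) * \<sigma>2 / 2))
          = complex_of_real l * (?\<psi> ?u - 1) - ?c"
        unfolding u2 using l by (simp add: field_simps)
      finally show "cmod (complex_of_real l * (?\<psi> ?u - 1) - ?c) \<le> t\<^sup>2 / 6 * ?r ?u" .
    qed
    \<comment> \<open>The minimum allows dominated convergence with second moments alone: its cubic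
      branch tends to 0 pointwise, and its quadratic branch is the integrable bound.\<close>
    have "((\<lambda>l. ?r (t / sqrt l)) \<longlongrightarrow> expectation (\<lambda>\<omega>. 0)) at_top"
    proof (rule integral_dominated_convergence_at_top[where w = "\<lambda>\<omega>. 6 * (Z \<omega>)\<^sup>2"])
      show "AE \<omega> in M. ((\<lambda>l. min (6 * (Z \<omega>)\<^sup>2) (\<bar>t / sqrt l\<bar> * \<bar>Z \<omega>\<bar> ^ 3)) \<longlongrightarrow> 0) at_top"
      proof (rule AE_I2)
        fix \<omega>
        have "((\<lambda>l. t / sqrt l) \<longlongrightarrow> 0) at_top"
          by (intro tendsto_divide_0[OF tendsto_const] filterlim_at_top_imp_at_infinity sqrt_at_top)
        hence "((\<lambda>l. min (6 * (Z \<omega>)\<^sup>2) (\<bar>t / sqrt l\<bar> * \<bar>Z \<omega>\<bar> ^ 3)) \<longlongrightarrow> min (6 * (Z \<omega>)\<^sup>2) (\<bar>0\<bar> * \<bar>Z \<omega>\<bar> ^ 3)) at_top"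
          by (intro tendsto_intros)
        thus "((\<lambda>l. min (6 * (Z \<omega>)\<^sup>2) (\<bar>t / sqrt l\<bar> * \<bar>Z \<omega>\<bar> ^ 3)) \<longlongrightarrow> 0) at_top"
          by (simp add: min_absorb2)
      qed
      show "\<forall>\<^sub>F l in at_top. AE \<omega> in M. norm (min (6 * (Z \<omega>)\<^sup>2) (\<bar>t / sqrt l\<bar> * \<bar>Z \<omega>\<bar> ^ 3)) \<le> 6 * (Z \<omega>)\<^sup>2"
        by (intro always_eventually allI AE_I2) (auto simp: min_def)
    qed (use Z in auto)
    thus "((\<lambda>l. t\<^sup>2 / 6 * ?r (t / sqrt l)) \<longlongrightarrow> 0) at_top"
      by (intro tendsto_mult_right_zero) simp
  qed
qed

text \<open>
  The summand is \<open>(X - \<mu>) / sqrt l + \<mu> / l\<close>, so its characteristic function factors into that of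
  the centred variable at \<open>t / sqrt l\<close> and a phase with argument \<open>t * \<mu> / l\<close>.
\<close>

lemma summand_char_scaled_limit:
  assumes X [measurable]: "X \<in> borel_measurable M"
    and int: "integrable M X" "integrable M (\<lambda>\<omega>. (X \<omega>)\<^sup>2)"
    and mean: "expectation X = \<mu>" and var: "variance X = \<sigma>2"
  shows "((\<lambda>l. complex_of_real l *
             (char (distr M borel (\<lambda>\<omega>. 1 / sqrt l * (X \<omega> + \<mu> * (1 / sqrt l - 1)))) t - 1))
           \<longlongrightarrow> \<i> * complex_of_real t * complex_of_real \<mu> - complex_of_real (t\<^sup>2 * \<sigma>2 / 2)) at_top"
proof -
  let ?\<psi> = "char (distr M borel (\<lambda>\<omega>. X \<omega> - \<mu>))"
  have "((\<lambda>l. complex_of_real l * (?\<psi> (t / sqrt l) - 1))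
            \<longlongrightarrow> complex_of_real (- (t\<^sup>2 * \<sigma>2 / 2))) at_top"
  proof (rule centred_char_scaled_limit)
    show "expectation (\<lambda>\<omega>. X \<omega> - \<mu>) = 0" using int mean by (simp add: prob_space)
    thus "variance (\<lambda>\<omega>. X \<omega> - \<mu>) = \<sigma>2" using var mean by simp
    show "integrable M (\<lambda>\<omega>. (X \<omega> - \<mu>)\<^sup>2)" using int by (simp add: power2_diff)
  qed (use int in auto)
  moreover have "((\<lambda>l. iexp (t * \<mu> / l)) \<longlongrightarrow> iexp 0) at_top"
  proof -
    have "((\<lambda>l. t * \<mu> / l) \<longlongrightarrow> 0) at_top"
      by (intro tendsto_divide_0[OF tendsto_const] filterlim_at_top_imp_at_infinity filterlim_ident)
    thus ?thesis by (intro tendsto_intros)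
  qed
  \<comment> \<open>With \<open>e\<close> the phase, \<open>l * (\<psi> * e - 1)\<close> is split as
    \<open>l * (\<psi> - 1) * e + l * (e - 1)\<close>: the first term yields the variance part, the
    second the drift.\<close>
  ultimately have "((\<lambda>l. complex_of_real l * (?\<psi> (t / sqrt l) - 1) * iexp (t * \<mu> / l)
        + complex_of_real l * (iexp (t * \<mu> / l) - 1))
      \<longlongrightarrow> complex_of_real (- (t\<^sup>2 * \<sigma>2 / 2)) * iexp 0 + \<i> * complex_of_real (t * \<mu>)) at_top"
    by (intro tendsto_add tendsto_mult iexp_scaled_limit)
  hence lim: "((\<lambda>l. complex_of_real l * (?\<psi> (t / sqrt l) - 1) * iexp (t * \<mu> / l)
        + complex_of_real l * (iexp (t * \<mu> / l) - 1))
      \<longlongrightarrow> \<i> * complex_of_real t * complex_of_real \<mu> - complex_of_real (t\<^sup>2 * \<sigma>2 / 2)) at_top"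
    by (simp add: mult.assoc)
  show ?thesis
  proof (rule Lim_transform_eventually[OF lim])
    show "\<forall>\<^sub>F l in at_top. complex_of_real l * (?\<psi> (t / sqrt l) - 1) * iexp (t * \<mu> / l)
        + complex_of_real l * (iexp (t * \<mu> / l) - 1) =
        complex_of_real l * (char (distr M borel (\<lambda>\<omega>. 1 / sqrt l * (X \<omega> + \<mu> * (1 / sqrt l - 1)))) t - 1)"
      using eventually_gt_at_top[of 0]
    proof eventually_elim
      fix l :: real assume l: "0 < l"
      have "iexp (t * (1 / sqrt l * (x + \<mu> * (1 / sqrt l - 1)))) = iexp (t / sqrt l * (x - \<mu>)) * iexp (t * \<mu> / l)" for x
      proof -
        have "t * (q * (x + \<mu> * (q - 1))) = t * q * (x - \<mu>) + t * \<mu> * (q * q)" for q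
          by (simp add: algebra_simps)
        from this[of "1 / sqrt l"] have "t * (1 / sqrt l * (x + \<mu> * (1 / sqrt l - 1)))
            = t / sqrt l * (x - \<mu>) + t * \<mu> / l" using l by simp
        thus ?thesis by (simp only: of_real_add distrib_left exp_add)
      qed
      hence "char (distr M borel (\<lambda>\<omega>. 1 / sqrt l * (X \<omega> + \<mu> * (1 / sqrt l - 1)))) t
          = (\<integral>\<omega>. iexp (t / sqrt l * (X \<omega> - \<mu>)) * iexp (t * \<mu> / l) \<partial>M)"
        by (subst char_def, subst integral_distr) simp_all
      also have "\<dots> = ?\<psi> (t / sqrt l) * iexp (t * \<mu> / l)"
        by (simp add: char_def integral_distr)
      finally have *: "char (distr M borel (\<lambda>\<omega>. 1 / sqrt l * (X \<omega> + \<mu> * (1 / sqrt l - 1)))) t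
          = ?\<psi> (t / sqrt l) * iexp (t * \<mu> / l)" .
      show "complex_of_real l * (?\<psi> (t / sqrt l) - 1) * iexp (t * \<mu> / l)
        + complex_of_real l * (iexp (t * \<mu> / l) - 1) =
        complex_of_real l * (char (distr M borel (\<lambda>\<omega>. 1 / sqrt l * (X \<omega> + \<mu> * (1 / sqrt l - 1)))) t - 1)"
        unfolding * by (simp add: algebra_simps)
    qed
  qed
qed

section \<open>Mixing over the law of \<open>W\<close>\<close>

text \<open>With \<open>W\<close> positive and the real part of \<open>s l\<close> at most 0, the
  integrands have modulus at most 1, so the constant 1 dominates.\<close>

lemma laplace_transform_tendsto:
  assumes W [measurable]: "W \<in> borel_measurable M" and pos: "AE \<omega> in M. 0 < W \<omega>"
    and s: "(s \<longlongrightarrow> s0) at_top" "\<forall>\<^sub>F l in at_top. Re (s l) \<le> 0"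
  shows "((\<lambda>l::real. \<integral>\<omega>. exp (s l * complex_of_real (W \<omega>)) \<partial>M)
           \<longlongrightarrow> (\<integral>\<omega>. exp (s0 * complex_of_real (W \<omega>)) \<partial>M)) at_top"
proof (rule integral_dominated_convergence_at_top[where w = "\<lambda>_. 1"])
  show "AE \<omega> in M. ((\<lambda>l. exp (s l * complex_of_real (W \<omega>))) \<longlongrightarrow> exp (s0 * complex_of_real (W \<omega>))) at_top"
    using s by (intro AE_I2 tendsto_intros)
  show "\<forall>\<^sub>F l in at_top. AE \<omega> in M. cmod (exp (s l * complex_of_real (W \<omega>))) \<le> 1"
    using s(2)
  proof eventually_elim
    fix l assume "Re (s l) \<le> 0"
    show "AE \<omega> in M. cmod (exp (s l * complex_of_real (W \<omega>))) \<le> 1"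
      using pos by eventually_elim (use \<open>Re (s l) \<le> 0\<close> in \<open>simp add: mult_nonpos_nonneg\<close>)
  qed
qed auto

text \<open>The limit law is that of \<open>\<mu> * W + \<sigma> * sqrt W * Z\<close> with \<open>Z\<close> standard normal and independent of \<open>W\<close>.\<close>

lemma normal_mixture_exists:
  fixes \<mu> \<sigma> :: real
  assumes W [measurable]: "W \<in> borel_measurable M" and pos: "AE \<omega> in M. 0 < W \<omega>"
  obtains Y where "real_distribution Y"
    "\<And>t. char Y t = (\<integral>\<omega>. exp ((\<i> * complex_of_real t * complex_of_real \<mu> -
       complex_of_real (t\<^sup>2 * \<sigma>\<^sup>2 / 2)) * complex_of_real (W \<omega>)) \<partial>M)"
proof -
  interpret Z: real_distribution std_normal_distribution by (rule real_dist_normal_dist)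
  interpret P: pair_prob_space M std_normal_distribution ..
  define f where "f = (\<lambda>x. \<mu> * W (fst x) + \<sigma> * sqrt (W (fst x)) * snd x)"
  have fm [measurable]: "f \<in> borel_measurable (M \<Otimes>\<^sub>M std_normal_distribution)"
    unfolding f_def by measurable
  have "char (distr (M \<Otimes>\<^sub>M std_normal_distribution) borel f) t =
      (\<integral>\<omega>. exp ((\<i> * complex_of_real t * complex_of_real \<mu> -
         complex_of_real (t\<^sup>2 * \<sigma>\<^sup>2 / 2)) * complex_of_real (W \<omega>)) \<partial>M)" for t
  proof -
    have "char (distr (M \<Otimes>\<^sub>M std_normal_distribution) borel f) t
        = (\<integral>x. iexp (t * f x) \<partial>(M \<Otimes>\<^sub>M std_normal_distribution))"
      by (simp add: char_def integral_distr)
    also have "\<dots> = (\<integral>\<omega>. (\<integral>z. iexp (t * f (\<omega>, z)) \<partial>std_normal_distribution) \<partial>M)"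
      by (rule P.integral_fst'[symmetric]) (rule P.integrable_const_bound[where B = 1], auto)
    \<comment> \<open>For fixed \<omega> the inner integral is a phase times the normal
      characteristic function at \<open>t * \<sigma> * sqrt (W \<omega>)\<close>.\<close>
    also have "\<dots> = (\<integral>\<omega>. iexp (t * \<mu> * W \<omega>) * char std_normal_distribution (t * \<sigma> * sqrt (W \<omega>)) \<partial>M)"
      by (intro Bochner_Integration.integral_cong)
         (simp_all add: f_def char_def exp_add distrib_left mult.assoc)
    also have "\<dots> = (\<integral>\<omega>. exp ((\<i> * complex_of_real t * complex_of_real \<mu> -
         complex_of_real (t\<^sup>2 * \<sigma>\<^sup>2 / 2)) * complex_of_real (W \<omega>)) \<partial>M)"
    proof (rule integral_cong_AE)
      show "AE \<omega> in M. iexp (t * \<mu> * W \<omega>) * char std_normal_distribution (t * \<sigma> * sqrt (W \<omega>)) =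
          exp ((\<i> * complex_of_real t * complex_of_real \<mu> -
         complex_of_real (t\<^sup>2 * \<sigma>\<^sup>2 / 2)) * complex_of_real (W \<omega>))"
        using pos
      proof eventually_elim
        fix \<omega> assume w: "0 < W \<omega>"
        have sq: "(t * \<sigma> * sqrt (W \<omega>))\<^sup>2 = t\<^sup>2 * \<sigma>\<^sup>2 * W \<omega>" using w by (simp add: power_mult_distrib)
        have "char std_normal_distribution (t * \<sigma> * sqrt (W \<omega>)) = exp (complex_of_real (- (t\<^sup>2 * \<sigma>\<^sup>2 * W \<omega>) / 2))"
          unfolding char_std_normal_distribution sq exp_of_real ..
        thus "iexp (t * \<mu> * W \<omega>) * char std_normal_distribution (t * \<sigma> * sqrt (W \<omega>)) =
          exp ((\<i> * complex_of_real t * complex_of_real \<mu> -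
         complex_of_real (t\<^sup>2 * \<sigma>\<^sup>2 / 2)) * complex_of_real (W \<omega>))"
          by (simp add: exp_add[symmetric] algebra_simps)
      qed
    qed measurable
    finally show ?thesis .
  qed
  moreover have "real_distribution (distr (M \<Otimes>\<^sub>M std_normal_distribution) borel f)"
    by (rule P.real_distribution_distr) (rule fm)
  ultimately show ?thesis using that by blast
qed

end

section \<open>Convergence of the normalised sums\<close>

theorem theorem2p2:
  fixes M :: "'a measure"
    and \<nu> :: "real measure"
    and b :: "real \<Rightarrow> real"
    and c :: "real \<Rightarrow> real \<Rightarrow> real"
    and \<xi>0 \<phi> \<mu> \<sigma> :: real
    and \<Theta> :: "real set"
    and W :: "'a \<Rightarrow> real"
    and N :: "real \<Rightarrow> 'a \<Rightarrow> nat"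
    and X :: "nat \<Rightarrow> 'a \<Rightarrow> real"
  assumes "prob_space M"
    and "exponential_family \<nu> b c \<xi>0 \<Theta>"
    and "\<phi> > 0"
    and "EF_distributed M \<nu> b c \<xi>0 \<phi> W"
    and "\<And>l. l > 0 \<Longrightarrow> mixed_poisson M l W (N l)"
    and "prob_space.indep_vars M (\<lambda>_. borel) X {1..}"
    and "\<And>n. n \<ge> 1 \<Longrightarrow> distr M borel (X n) = distr M borel (X 1)"
    and "\<And>l. l > 0 \<Longrightarrow>
           indep_rv M
             (\<Pi>\<^sub>M n\<in>{1..}. borel) (\<lambda>\<omega>. \<lambda>n\<in>{1..}. X n \<omega>) (count_space UNIV) (N l)"
    and "integrable M (X 1)"
    and "prob_space.expectation M (X 1) = \<mu>"
    and "integrable M (\<lambda>\<omega>. (X 1 \<omega>)\<^sup>2)"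
    and "prob_space.variance M (X 1) = \<sigma>\<^sup>2"
    and "\<sigma>\<^sup>2 > 0"
  defines "a \<equiv> \<lambda>l::real. 1 / sqrt l"
    and "d \<equiv> \<lambda>l::real. \<mu> * (1 / sqrt l - 1)"
  defines "S \<equiv> \<lambda>l \<omega>. a l * (\<Sum>i = 1..N l \<omega>. X i \<omega> + d l)"
  shows "\<exists>Y. real_distribution Y \<and>
           (\<forall>t::real. char Y t =
              exp (- (complex_of_real \<phi> *
                (analytic_extension \<Theta> b (complex_of_real \<xi>0) -
                 analytic_extension \<Theta> b
                   (complex_of_real \<xi>0 +
                    inverse (complex_of_real \<phi>) *
                      (\<i> * complex_of_real t * complex_of_real \<mu> -
                       complex_of_real (t\<^sup>2 * \<sigma>\<^sup>2 / 2)))))) ) \<and>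
           weak_conv_filter (\<lambda>l. distr M borel (S l)) Y at_top"
proof -
  interpret prob_space M by fact
  interpret exponential_family \<nu> b c \<xi>0 \<Theta> by fact
  note \<phi> = \<open>\<phi> > 0\<close> and mp = assms(5) and X_indep = assms(6) and X_distr = assms(7) and XN = assms(8)
  from assms(4) have W_distr: "distributed M \<nu> W (\<lambda>w. ennreal (ef_density b c \<phi> \<xi>0 w))"
    and W_pos: "AE \<omega> in M. 0 < W \<omega>"
    unfolding EF_distributed_def by auto
  have Wm [measurable]: "W \<in> borel_measurable M" using mp[of 1] unfolding mixed_poisson_def by simp
  have Xm [measurable]: "X i \<in> borel_measurable M" if "i \<ge> 1" for i
    using X_indep that unfolding indep_vars_def2 by auto
  \<comment> \<open>The density is stated for \<open>W\<close> as a map into \<nu>; the push-forward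
    to \<open>borel\<close> is the same measure because the two \<sigma>-algebras coincide.\<close>
  have W_law: "distr M borel W = ef_law \<phi>"
    using distributed_distr_eq_density[OF W_distr] distr_cong[OF refl sets_nu, of M W W]
    by (simp add: ef_law_def)
  define s where "s t = \<i> * complex_of_real t * complex_of_real \<mu> - complex_of_real (t\<^sup>2 * \<sigma>\<^sup>2 / 2)" for t
  have target: "(\<integral>\<omega>. exp (s t * complex_of_real (W \<omega>)) \<partial>M) =
      exp (- (complex_of_real \<phi> * (analytic_extension \<Theta> b (complex_of_real \<xi>0) -
        analytic_extension \<Theta> b (complex_of_real \<xi>0 + inverse (complex_of_real \<phi>) * s t))))" for t
  proof -
    have "(\<integral>\<omega>. exp (s t * complex_of_real (W \<omega>)) \<partial>M) = (\<integral>w. exp (s t * complex_of_real w) \<partial>distr M borel W)"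
      by (simp add: integral_distr)
    \<comment> \<open>The real part of \<open>s t\<close> is
      \<open>- t\<^sup>2 * \<sigma>\<^sup>2 / 2\<close>, so the point lies at or to the left of
      \<xi>0.\<close>
    moreover have "\<xi>0 + Re (s t) / \<phi> \<in> \<Theta>"
      using Theta_lower \<phi> by (auto simp: s_def)
    ultimately show ?thesis unfolding W_law by (simp only: ef_law_complex_exp[OF \<phi>])
  qed
  obtain Y where Y: "real_distribution Y"
    and char_Y: "\<And>t. char Y t = (\<integral>\<omega>. exp (s t * complex_of_real (W \<omega>)) \<partial>M)"
    using normal_mixture_exists[OF Wm W_pos, of \<mu> \<sigma>] unfolding s_def by blast
  define g where "g t l = char (distr M borel (\<lambda>\<omega>. a l * (X 1 \<omega> + d l))) t" for t l
  have g_le: "cmod (g t l) \<le> 1" for t l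
    unfolding g_def by (intro real_distribution.cmod_char_le_1 real_distribution_distr) simp
  \<comment> \<open>Moving the factor \<open>a l\<close> inside makes \<open>S l\<close> a compound
    sum whose summands have characteristic function \<open>g t l\<close> at
    \<open>t\<close>.\<close>
  have S_eq: "S l = (\<lambda>\<omega>. \<Sum>i = 1..N l \<omega>. a l * (X i \<omega> + d l))" for l
    by (simp add: S_def sum_distrib_left)
  \<comment> \<open>Both lemmas evaluate the same series, once as a characteristic function and once
    as a mixture over \<open>W\<close>; the two values agree by uniqueness of sums.\<close>
  have char_S: "char (distr M borel (S l)) t =
      (\<integral>\<omega>. exp (complex_of_real l * (g t l - 1) * complex_of_real (W \<omega>)) \<partial>M)" if l: "0 < l" for l t
    using char_compound_sum[OF X_indep X_distr XN[OF l], of "\<lambda>x. a l * (x + d l)" t]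
      mixed_poisson_pgf[OF mp[OF l] l W_pos g_le[of t l]]
    unfolding S_eq g_def by (intro sums_unique2) auto
  have S_meas: "S l \<in> borel_measurable M" if l: "0 < l" for l
  proof -
    have [measurable]: "N l \<in> measurable M (count_space UNIV)"
      using mp[OF l] unfolding mixed_poisson_def by auto
    have "(\<lambda>\<omega>. \<Sum>i = 1..k. a l * (X i \<omega> + d l)) \<in> borel_measurable M" for k
      by (intro borel_measurable_sum) auto
    thus ?thesis unfolding S_eq by (rule measurable_compose_countable) simp
  qed
  have "weak_conv_filter (\<lambda>l. distr M borel (S l)) Y at_top"
  proof (rule levy_continuity_at_top[OF _ Y])
    show "real_distribution (distr M borel (S l))" if "0 < l" for l
      using S_meas[OF that] by (rule real_distribution_distr)
    fix t
    have "((\<lambda>l. complex_of_real l * (g t l - 1)) \<longlongrightarrow> s t) at_top"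
      unfolding g_def s_def a_def d_def
      by (rule summand_char_scaled_limit) (use assms in auto)
    \<comment> \<open>A characteristic function has modulus at most 1, so \<open>g t l - 1\<close>
      has real part at most 0.\<close>
    moreover have "\<forall>\<^sub>F l in at_top. Re (complex_of_real l * (g t l - 1)) \<le> 0"
      using eventually_gt_at_top[of 0]
    proof eventually_elim
      fix l :: real assume "0 < l"
      moreover have "Re (g t l) \<le> 1" using complex_Re_le_cmod[of "g t l"] g_le[of t l] by linarith
      ultimately show "Re (complex_of_real l * (g t l - 1)) \<le> 0" by (simp add: mult_nonneg_nonpos)
    qed
    ultimately have "((\<lambda>l. \<integral>\<omega>. exp (complex_of_real l * (g t l - 1) * complex_of_real (W \<omega>)) \<partial>M)
        \<longlongrightarrow> char Y t) at_top"
      unfolding char_Y by (rule laplace_transform_tendsto[OF Wm W_pos])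
    thus "((\<lambda>l. char (distr M borel (S l)) t) \<longlongrightarrow> char Y t) at_top"
      by (rule Lim_transform_eventually)
         (use eventually_gt_at_top[of 0] in eventually_elim, simp add: char_S)
  qed
  with Y char_Y target show ?thesis unfolding s_def by auto
qed

end
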